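(* Let $q\geq 3$ be an integer, let $G\in\mathcal{A}(q)$ with maximum degree $t\geq q+2$, and let $f$ and $g$ be two different proper $t$-colorings of $G$. If the subgraph $G(f,g,t)$ has a component $C$ which is a cycle containing a cutvertex of $G$, then there is a proper $t$-coloring $\overline f$ of $G$ such that $\overline f$ is $(q+1)$-equivalent to $f$ and $|M(\overline f,t)\cap M(g,t)|>|M(f,t)\cap M(g,t)|$.
   Context: Graphs are finite and simple. A $t$-coloring of $G$ is a map $f:E(G)\to\{1,\dots,t\}$; it is proper if adjacent edges get distinct colors. $M(f,j)$ is the set of edges of color $j$ under $f$. For an integer $q\geq 2$, $\mathcal{A}(q)$ is the set of graphs $G$ such that every subgraph $H$ of $G$ with $\Delta(H)\leq q$ has a proper $q$-edge-coloring. $G(f,g,t)$ is the subgraph of $G$ formed by the edge set $M(f,t)\triangle M(g,t)$ together with its endpoints. Two $t$-colorings differ by at most $n$ color classes if the number of colors $j$ with $M(f,j)\neq M(g,j)$ is at most $n$. Two proper $t$-colorings $f,h$ are $n$-equivalent if there is a sequence $f_0=f,f_1,\dots,f_k=h$ ($k\geq 1$) of proper $t$-colorings of $G$ with $f_i$ differing from $f_{i-1}$ by at most $n$ color classes for each $i$. *)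

theory Defs
  imports "HOL-Library.FuncSet"
begin

datatype 'a graph = Graph (verts: "'a set") (edges: "'a set set")

text \<open>Finite simple graphs: an edge is the two-element set of its endpoints.\<close>

definition simple_graph :: "'a graph \<Rightarrow> bool" where
  "simple_graph G \<longleftrightarrow> finite (verts G) \<and> (\<forall>e\<in>edges G. e \<subseteq> verts G \<and> card e = 2)"

definition subgraph :: "'a graph \<Rightarrow> 'a graph \<Rightarrow> bool" where
  "subgraph H G \<longleftrightarrow> simple_graph H \<and> verts H \<subseteq> verts G \<and> edges H \<subseteq> edges G"

definition degree :: "'a graph \<Rightarrow> 'a \<Rightarrow> nat" where
  "degree G v = card {e \<in> edges G. v \<in> e}"

text \<open>The inserted 0 only matters for the graph without vertices, whose maximum degree is thus 0.\<close>

definition max_degree :: "'a graph \<Rightarrow> nat" where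
  "max_degree G = Max (insert 0 (degree G ` verts G))"

definition connected_graph :: "'a graph \<Rightarrow> bool" where
  "connected_graph G \<longleftrightarrow> verts G \<noteq> {} \<and>
     (\<forall>u\<in>verts G. \<forall>v\<in>verts G. (u, v) \<in> {(x, y). {x, y} \<in> edges G}\<^sup>*)"

definition components :: "'a graph \<Rightarrow> 'a graph set" where
  "components G = {C. subgraph C G \<and> connected_graph C \<and>
     (\<forall>D. subgraph D G \<and> connected_graph D \<and> subgraph C D \<longrightarrow> D = C)}"

definition delete_vertex :: "'a graph \<Rightarrow> 'a \<Rightarrow> 'a graph" where
  "delete_vertex G v = Graph (verts G - {v}) {e \<in> edges G. v \<notin> e}"

definition cutvertex :: "'a graph \<Rightarrow> 'a \<Rightarrow> bool" where
  "cutvertex G v \<longleftrightarrow> v \<in> verts G \<and>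
     card (components (delete_vertex G v)) > card (components G)"

definition is_cycle :: "'a graph \<Rightarrow> bool" where
  "is_cycle C \<longleftrightarrow> (\<exists>vs. distinct vs \<and> length vs \<ge> 3 \<and> verts C = set vs \<and>
     edges C = {{vs ! i, vs ! (Suc i mod length vs)} |i. i < length vs})"

text \<open>Colorings are extensional functions on the edge set, so that equality of colorings
  is equality of maps defined on the edges only.\<close>

definition coloring :: "'a graph \<Rightarrow> nat \<Rightarrow> ('a set \<Rightarrow> nat) \<Rightarrow> bool" where
  "coloring G t f \<longleftrightarrow> f \<in> edges G \<rightarrow>\<^sub>E {1..t}"

definition proper_coloring :: "'a graph \<Rightarrow> nat \<Rightarrow> ('a set \<Rightarrow> nat) \<Rightarrow> bool" where
  "proper_coloring G t f \<longleftrightarrow> coloring G t f \<and>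
     (\<forall>e\<in>edges G. \<forall>e'\<in>edges G. e \<noteq> e' \<and> e \<inter> e' \<noteq> {} \<longrightarrow> f e \<noteq> f e')"

definition color_class :: "'a graph \<Rightarrow> ('a set \<Rightarrow> nat) \<Rightarrow> nat \<Rightarrow> 'a set set" where
  "color_class G f j = {e \<in> edges G. f e = j}"

definition class_A :: "nat \<Rightarrow> 'a graph set" where
  "class_A q = {G. simple_graph G \<and>
     (\<forall>H. subgraph H G \<and> max_degree H \<le> q \<longrightarrow> (\<exists>h. proper_coloring H q h))}"

definition diff_subgraph :: "'a graph \<Rightarrow> ('a set \<Rightarrow> nat) \<Rightarrow> ('a set \<Rightarrow> nat) \<Rightarrow> nat \<Rightarrow> 'a graph" where
  "diff_subgraph G f g j =
     (let D = sym_diff (color_class G f j) (color_class G g j) in Graph (\<Union>D) D)"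

definition differ_at_most ::
    "'a graph \<Rightarrow> nat \<Rightarrow> nat \<Rightarrow> ('a set \<Rightarrow> nat) \<Rightarrow> ('a set \<Rightarrow> nat) \<Rightarrow> bool" where
  "differ_at_most G t n f g \<longleftrightarrow>
     card {j \<in> {1..t}. color_class G f j \<noteq> color_class G g j} \<le> n"

definition n_equivalent ::
    "'a graph \<Rightarrow> nat \<Rightarrow> nat \<Rightarrow> ('a set \<Rightarrow> nat) \<Rightarrow> ('a set \<Rightarrow> nat) \<Rightarrow> bool" where
  "n_equivalent G t n f h \<longleftrightarrow>
     (\<exists>k::nat. k \<ge> 1 \<and> (\<exists>F. F 0 = f \<and> F k = h \<and> (\<forall>i\<le>k. proper_coloring G t (F i)) \<and>
        (\<forall>i\<in>{1..k}. differ_at_most G t n (F i) (F (i - 1)))))"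

end

theory Submission
  imports Defs "HOL-Combinatorics.Transposition"
begin

text \<open>
  Let \<open>E1\<close> be the part of \<open>G\<close> on the side of the cutvertex \<open>v\<close> that contains the cycle \<open>x 0 = v, x 1, \<dots>\<close>,
  so that \<open>v\<close> misses some colour \<open>c\<close> in \<open>E1\<close>. Moving around the cycle from \<open>v\<close>, exchange the edges of
  colour \<open>t\<close> one pair at a time. An intermediate colouring is improper only at one vertex \<open>x (2 * j)\<close>,
  which is incident with two edges of colour \<open>t\<close> but misses a colour \<open>c\<close>. On any \<open>q\<close> colours including
  \<open>t\<close> and \<open>c\<close> it therefore has maximum degree at most \<open>q\<close>, and the class-\<open>\<A>(q)\<close> property repairs it into
  a proper colouring. Adding the colour of the next edge of the cycle gives \<open>q + 1\<close> colours within
  which both the exchange of the next pair and the passage between the repaired colourings happen;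
  the edges left after fixing the new class \<open>t\<close> again have maximum degree at most \<open>q\<close>.

  A recolouring of \<open>E1\<close> on a set of colours extends to \<open>G\<close> by permuting these colours on the remaining
  edges. In the end the class \<open>t\<close> is restored there by swapping \<open>t\<close> with its image; neither colour
  occurs at \<open>v\<close> on that side.
\<close>

section \<open>Edge colourings, changes of colour within a set, and the class
  \<open>class_A\<close>\<close>

definition proper_on :: "'a set set \<Rightarrow> ('a set \<Rightarrow> nat) \<Rightarrow> bool" where
  "proper_on X h \<longleftrightarrow> (\<forall>e\<in>X. \<forall>e'\<in>X. e \<noteq> e' \<and> e \<inter> e' \<noteq> {} \<longrightarrow> h e \<noteq> h e')"

text \<open>An edge whose colour lies in \<open>S\<close> may only be recoloured within \<open>S\<close>, so this is transitive
  also for colourings that are not proper.\<close>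

definition agree_outside :: "'a set set \<Rightarrow> nat set \<Rightarrow> ('a set \<Rightarrow> nat) \<Rightarrow> ('a set \<Rightarrow> nat) \<Rightarrow> bool" where
  "agree_outside E S f h \<longleftrightarrow> (\<forall>e\<in>E. f e = h e \<or> f e \<in> S \<and> h e \<in> S)"

definition recoloring_step :: "'a graph \<Rightarrow> nat \<Rightarrow> nat \<Rightarrow> (('a set \<Rightarrow> nat) \<times> ('a set \<Rightarrow> nat)) set" where
  "recoloring_step G t n =
     {(f, h). proper_coloring G t f \<and> proper_coloring G t h \<and> differ_at_most G t n f h}"

lemma proper_coloring_iff:
  "proper_coloring G t f \<longleftrightarrow> f \<in> edges G \<rightarrow>\<^sub>E {1..t} \<and> proper_on (edges G) f"
  by (simp add: proper_coloring_def coloring_def proper_on_def)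

lemma proper_onD:
  "proper_on X h \<Longrightarrow> e \<in> X \<Longrightarrow> e' \<in> X \<Longrightarrow> u \<in> e \<Longrightarrow> u \<in> e' \<Longrightarrow> h e = h e' \<Longrightarrow> e = e'"
  unfolding proper_on_def by blast

lemma agree_outside_sym: "agree_outside E S f h \<Longrightarrow> agree_outside E S h f"
  unfolding agree_outside_def by metis

lemma agree_outside_trans:
  "agree_outside E S f g \<Longrightarrow> agree_outside E S g h \<Longrightarrow> agree_outside E S f h"
  unfolding agree_outside_def by metis

lemma agree_outside_mono: "agree_outside E S f g \<Longrightarrow> S \<subseteq> S' \<Longrightarrow> agree_outside E S' f g"
  unfolding agree_outside_def by blast

text \<open>An edge that enters or leaves the class of \<open>j\<close> changes its colour, so both
  of its colours, one of which is \<open>j\<close>, lie in \<open>S\<close>.\<close>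

lemma differ_at_most_if_agree_outside:
  assumes "agree_outside (edges G) S f h" "finite S" "card S \<le> n"
  shows "differ_at_most G t n f h"
proof -
  have "{j \<in> {1..t}. color_class G f j \<noteq> color_class G h j} \<subseteq> S"
    using assms(1) unfolding agree_outside_def color_class_def by fastforce
  then show ?thesis
    unfolding differ_at_most_def using card_mono[OF assms(2)] assms(3) le_trans by blast
qed

lemma finite_edges: "simple_graph G \<Longrightarrow> finite (edges G)"
  unfolding simple_graph_def by (rule finite_subset[of _ "Pow (verts G)"]) auto

lemma class_A_simple: "G \<in> class_A q \<Longrightarrow> simple_graph G"
  by (simp add: class_A_def)

text \<open>Allows the exchange to be carried out on one side of the cutvertex alone.\<close>

lemma class_A_edge_subset:
  assumes "G \<in> class_A q" "E \<subseteq> edges G"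
  shows "Graph (verts G) E \<in> class_A q"
proof -
  have "subgraph H G" if "subgraph H (Graph (verts G) E)" for H
    using that assms(2) by (auto simp: subgraph_def)
  moreover have "simple_graph (Graph (verts G) E)"
    using class_A_simple[OF assms(1)] assms(2) by (auto simp: simple_graph_def)
  ultimately show ?thesis using assms(1) by (simp add: class_A_def)
qed

text \<open>The form in which \<open>class_A\<close> is used: the graph is replaced by an edge set,
  and the colours \<open>{1..q}\<close> by an arbitrary set of \<open>q\<close> colours through a
  bijection.\<close>

lemma class_A_proper_on:
  assumes "G \<in> class_A q" "X \<subseteq> edges G" "\<And>v. card {e \<in> X. v \<in> e} \<le> q"
    and "finite T" "card T = q"
  obtains h where "h ` X \<subseteq> T" "proper_on X h"
proof -
  let ?H = "Graph (verts G) X"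
  have "simple_graph G" using assms(1) by (rule class_A_simple)
  then have "subgraph ?H G" and fin: "finite (verts G)"
    using assms(2) unfolding subgraph_def simple_graph_def by auto
  moreover have "max_degree ?H \<le> q"
    unfolding max_degree_def degree_def using assms(3) fin by auto
  ultimately obtain h where h: "proper_coloring ?H q h"
    using assms(1) unfolding class_A_def by blast
  obtain \<beta> where \<beta>: "bij_betw \<beta> {1..q} T"
    using finite_same_card_bij[of "{1..q}" T] assms(4,5) by auto
  have hX: "h ` X \<subseteq> {1..q}" using h unfolding proper_coloring_iff by auto
  show thesis
  proof
    show "(\<beta> \<circ> h) ` X \<subseteq> T"
      using hX \<beta> unfolding bij_betw_def by auto
    show "proper_on X (\<beta> \<circ> h)"
      using h hX inj_on_eq_iff[OF bij_betw_imp_inj_on[OF \<beta>]]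
      unfolding proper_coloring_iff proper_on_def by (simp add: image_subset_iff)
  qed
qed

lemma obtain_set_between:
  assumes "B \<subseteq> A" "finite A" "card B \<le> n" "n \<le> card A"
  obtains S where "B \<subseteq> S" "S \<subseteq> A" "card S = n"
  using exists_subset_between[of B n A] assms by blast

section \<open>Exchanging the edges of colour \<open>t\<close> along an alternating cycle\<close>

text \<open>Meant for the part of the graph on one side of the cutvertex \<open>x 0\<close>. The
  even edges of the cycle are to leave the class of \<open>t\<close>, the odd ones to join
  it.\<close>

locale alternating_cycle =
  fixes G :: "'a graph" and q t :: nat and f :: "'a set \<Rightarrow> nat" and x :: "nat \<Rightarrow> 'a" and k :: nat
  assumes class_A: "G \<in> class_A q"
    and q: "2 \<le> q" and t: "q + 1 \<le> t"
    and proper: "proper_coloring G t f"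
    and k: "2 \<le> k"
    and inj: "inj_on x {..<2 * k}"
    and closed: "x (2 * k) = x 0"
    and even_edge: "\<And>i. i < k \<Longrightarrow> {x (2 * i), x (2 * i + 1)} \<in> color_class G f t"
    and odd_edge: "\<And>i. i < k \<Longrightarrow> {x (2 * i + 1), x (2 * i + 2)} \<in> edges G - color_class G f t"
begin

definition ev :: "nat \<Rightarrow> 'a set" where "ev i = {x (2 * i), x (2 * i + 1)}"

definition od :: "nat \<Rightarrow> 'a set" where "od i = {x (2 * i + 1), x (2 * i + 2)}"

text \<open>The colour class \<open>t\<close> after the exchange along the first \<open>2 * j\<close> edges of the cycle. For \<open>0 < j < k\<close> it is not
  a matching: exactly the edges \<open>od (j - 1)\<close> and \<open>ev j\<close> clash, at \<open>x (2 * j)\<close>.\<close>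

definition shifted :: "nat \<Rightarrow> 'a set set" where
  "shifted j = color_class G f t - ev ` {..<j} \<union> od ` {..<j}"

text \<open>All clashes of \<open>h\<close> are inside the class \<open>t\<close>, and \<open>c\<close> is a colour missing at the vertex of the clash.\<close>

definition state :: "nat \<Rightarrow> ('a set \<Rightarrow> nat) \<Rightarrow> nat \<Rightarrow> bool" where
  "state j h c \<longleftrightarrow> h ` edges G \<subseteq> {1..t} \<and> (\<forall>e\<in>edges G. h e = t \<longleftrightarrow> e \<in> shifted j) \<and>
     (\<forall>e\<in>edges G. \<forall>e'\<in>edges G. e \<noteq> e' \<and> e \<inter> e' \<noteq> {} \<and> h e = h e' \<longrightarrow> h e = t) \<and>
     c \<in> {1..t} \<and> c \<noteq> t \<and> (\<forall>e\<in>edges G. x (2 * j) \<in> e \<longrightarrow> h e \<noteq> c)"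

lemma ev_color: "i < k \<Longrightarrow> ev i \<in> edges G" "i < k \<Longrightarrow> f (ev i) = t"
  using even_edge[of i] by (auto simp: ev_def color_class_def)

lemma od_color: "i < k \<Longrightarrow> od i \<in> edges G" "i < k \<Longrightarrow> f (od i) \<noteq> t"
  using odd_edge[of i] by (auto simp: od_def color_class_def)

lemma finite_E: "finite (edges G)"
  using class_A class_A_simple finite_edges by blast

lemma x_eq: "a < 2 * k \<Longrightarrow> b < 2 * k \<Longrightarrow> x a = x b \<longleftrightarrow> a = b"
  using inj by (auto simp: inj_on_def)

text \<open>The indices are shifted by one because the last odd edge ends at
  \<open>x (2 * k)\<close>, not at \<open>x 0\<close>.\<close>

lemma x_eq': "0 < a \<Longrightarrow> a \<le> 2 * k \<Longrightarrow> 0 < b \<Longrightarrow> b \<le> 2 * k \<Longrightarrow> x a = x b \<longleftrightarrow> a = b"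
  using x_eq[of a b] x_eq[of 0 b] x_eq[of a 0] closed
  by (cases "a = 2 * k"; cases "b = 2 * k") auto

text \<open>The index pairs \<open>2 * i + 1\<close>, \<open>2 * i + 2\<close> partition the indices
  from \<open>1\<close> to \<open>2 * k\<close>, on which \<open>x\<close> is injective.\<close>

lemma od_disjoint: "i < k \<Longrightarrow> i' < k \<Longrightarrow> u \<in> od i \<Longrightarrow> u \<in> od i' \<Longrightarrow> i = i'"
  unfolding od_def using x_eq'[of "2*i+1" "2*i'+1"] x_eq'[of "2*i+1" "2*i'+2"]
    x_eq'[of "2*i+2" "2*i'+1"] x_eq'[of "2*i+2" "2*i'+2"]
  by auto

lemma ev_unique: "i < k \<Longrightarrow> u \<in> ev i \<Longrightarrow> u \<in> e \<Longrightarrow> e \<in> edges G \<Longrightarrow> f e = t \<Longrightarrow> e = ev i"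
  using proper_onD[of "edges G" f e "ev i" u] proper ev_color unfolding proper_coloring_iff by auto

lemma shifted_subset: "j \<le> k \<Longrightarrow> shifted j \<subseteq> edges G"
  unfolding shifted_def using od_color by (auto simp: color_class_def)

text \<open>At \<open>x (2 * i + 1)\<close> the edge of colour \<open>t\<close> is
  \<open>ev i\<close>, already removed. At \<open>x (2 * i + 2)\<close> it is
  \<open>ev (i + 1)\<close>, still present only if \<open>i + 1 = j\<close>; for
  \<open>i + 1 = k\<close> it is \<open>ev 0\<close>, which was removed first.\<close>

lemma shifted_conflict_od:
  assumes "j \<le> k" "i < j" "e \<in> edges G" "f e = t" "e \<notin> ev ` {..<j}" "u \<in> e" "u \<in> od i"
  shows "u = x (2 * j) \<and> j < k \<and> e = ev j"
proof -
  consider "u = x (2 * i + 1)" | "u = x (2 * i + 2)" using assms(7) unfolding od_def by auto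
  then show ?thesis
  proof cases
    case 1
    then have "e = ev i" using assms ev_unique[of i u e] by (auto simp: ev_def)
    then show ?thesis using assms by blast
  next
    case u: 2
    show ?thesis
    proof (cases "i + 1 < k")
      case True
      then have "e = ev (i + 1)"
        using assms u ev_unique[of "i + 1" u e] by (auto simp: ev_def)
      moreover then have "i + 1 = j" using assms by (metis Suc_eq_plus1 Suc_lessI image_eqI lessThan_iff)
      ultimately show ?thesis using True u by auto
    next
      case False
      then have "i + 1 = k" using assms by linarith
      then have "2 * i + 2 = 2 * k" by simp
      then have "u = x 0" using u closed by simp
      then have "e = ev 0" using assms k ev_unique[of 0 u e] by (auto simp: ev_def)
      then show ?thesis using assms by force
    qed
  qed
qed

text \<open>Two old edges do not meet because \<open>f\<close> is proper, and two odd edges are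
  disjoint, so an old edge meets an odd one. For \<open>j = k\<close> the conclusion is
  contradictory: the final class is a matching.\<close>

lemma shifted_conflict:
  assumes "j \<le> k" "e \<in> shifted j" "e' \<in> shifted j" "e \<noteq> e'" "u \<in> e" "u \<in> e'"
  shows "u = x (2 * j) \<and> j < k \<and> (e = ev j \<or> e' = ev j)"
proof -
  have F: "proper_on (edges G) f" using proper unfolding proper_coloring_iff by simp
  have in_shifted: "d \<in> color_class G f t - ev ` {..<j} \<or> (\<exists>i<j. d = od i)" if "d \<in> shifted j" for d
    using that unfolding shifted_def by blast
  consider "e \<in> color_class G f t - ev ` {..<j}" "e' \<in> color_class G f t - ev ` {..<j}"
    | i where "i < j" "e = od i" "e' \<in> color_class G f t - ev ` {..<j}"
    | i where "i < j" "e' = od i" "e \<in> color_class G f t - ev ` {..<j}"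
    | i i' where "i < j" "i' < j" "e = od i" "e' = od i'"
    using in_shifted[OF assms(2)] in_shifted[OF assms(3)] by metis
  then show ?thesis
  proof cases
    case 1
    then show ?thesis using proper_onD[OF F, of e e' u] assms by (auto simp: color_class_def)
  next
    case (2 i)
    then show ?thesis using shifted_conflict_od[of j i e' u] assms by (auto simp: color_class_def)
  next
    case (3 i)
    then show ?thesis using shifted_conflict_od[of j i e u] assms by (auto simp: color_class_def)
  next
    case (4 i i')
    then show ?thesis using od_disjoint[of i i' u] assms by auto
  qed
qed

lemma ev_in_shifted: "i < k \<Longrightarrow> j \<le> i \<Longrightarrow> ev i \<in> shifted j"
proof -
  assume i: "i < k" "j \<le> i"
  have "ev i \<noteq> ev i'" if "i' < j" for i'
    using that i x_eq[of "2*i" "2*i'"] x_eq[of "2*i" "2*i'+1"] by (auto simp: ev_def doubleton_eq_iff)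
  then show ?thesis using ev_color i unfolding shifted_def by (auto simp: color_class_def)
qed

lemma od_notin_shifted: "i < k \<Longrightarrow> j \<le> i \<Longrightarrow> od i \<notin> shifted j"
proof -
  assume i: "i < k" "j \<le> i"
  have "od i \<noteq> od i'" if "i' < j" for i'
    using that i od_disjoint[of i i' "x (2*i+1)"] by (auto simp: od_def)
  then show ?thesis using od_color i unfolding shifted_def by (auto simp: color_class_def)
qed

lemma shifted_Suc: "j < k \<Longrightarrow> shifted (Suc j) = insert (od j) (shifted j - {ev j})"
proof -
  assume j: "j < k"
  have "ev j \<notin> od ` {..<j}" using ev_color(2)[OF j] od_color(2) j by (metis imageE lessThan_iff less_trans)
  then show ?thesis unfolding shifted_def by (auto simp: lessThan_Suc)
qed

lemma stateD:
  assumes "state j h c"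
  shows "h ` edges G \<subseteq> {1..t}" and "\<forall>e\<in>edges G. h e = t \<longleftrightarrow> e \<in> shifted j"
    and "\<forall>e\<in>edges G. \<forall>e'\<in>edges G. e \<noteq> e' \<and> e \<inter> e' \<noteq> {} \<and> h e = h e' \<longrightarrow> h e = t"
    and "c \<in> {1..t}" and "c \<noteq> t" and "\<forall>e\<in>edges G. x (2 * j) \<in> e \<longrightarrow> h e \<noteq> c"
  using assms unfolding state_def by iprover+

lemma state_missing: "state j h c \<Longrightarrow> e \<in> edges G \<Longrightarrow> x (2 * j) \<in> e \<Longrightarrow> h e \<noteq> c"
  using stateD(6) by blast

lemma state_color: "state j h c \<Longrightarrow> e \<in> edges G \<Longrightarrow> h e \<in> {1..t}"
  using stateD(1) by blast

lemma state_shifted: "state j h c \<Longrightarrow> e \<in> edges G \<Longrightarrow> h e = t \<longleftrightarrow> e \<in> shifted j"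
  using stateD(2) by blast

lemma state_clash:
  assumes "state j h c" "e \<in> edges G" "e' \<in> edges G" "e \<noteq> e'" "u \<in> e" "u \<in> e'" "h e = h e'"
  shows "h e = t"
proof -
  have "e \<inter> e' \<noteq> {}" using assms by blast
  then show ?thesis using stateD(3)[OF assms(1)] assms(2-4,7) by metis
qed

text \<open>Degrees are bounded by counting colours: apart from \<open>t\<close>, the edges of a
  state at one vertex have distinct colours.\<close>

lemma inj_on_incident:
  assumes "state j h c" "Y \<subseteq> {e \<in> edges G. u \<in> e}" "\<And>e. e \<in> Y \<Longrightarrow> h e \<noteq> t"
  shows "inj_on h Y"
proof (rule inj_onI)
  fix e e' assume e: "e \<in> Y" "e' \<in> Y" "h e = h e'"
  then show "e = e'" using state_clash[OF assms(1), of e e' u] assms(2,3) by blast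
qed

text \<open>The edges with colours in \<open>S - {t}\<close>, with \<open>ev j\<close> added and
  \<open>od j\<close> removed, have maximum degree at most \<open>q\<close>. They are recoloured
  with the \<open>q\<close> colours of \<open>S - {t}\<close>, while \<open>od j\<close> receives
  \<open>t\<close> and the other edges of colour \<open>t\<close> keep it.\<close>

lemma step_state:
  assumes st: "state j h c" and j: "j < k"
    and S: "S \<subseteq> {1..t}" "card S = q + 1" "t \<in> S" "c \<in> S" "h (od j) \<in> S"
  obtains h' c' where "state (Suc j) h' c'" "agree_outside (edges G) S h h'" "c' \<in> S"
proof -
  let ?E = "edges G"
  define X where "X = insert (ev j) {e \<in> ?E. h e \<in> S - {t}} - {od j}"
  have finS: "finite S" using S(1) finite_subset by blast
  have finX: "finite X" using finite_E unfolding X_def by simp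
  have XE: "X \<subseteq> ?E" unfolding X_def using ev_color(1) j by auto
  have od_t: "h (od j) \<noteq> t" using state_shifted[OF st] od_notin_shifted od_color(1) j by blast
  have ev_t: "h (ev j) = t" using state_shifted[OF st] ev_in_shifted ev_color(1) j by blast
  \<comment> \<open>\<open>B\<close> will be a colour absent at \<open>u\<close>, which lowers the
    bound by one and makes room for \<open>ev j\<close>.\<close>
  have bound: "card {e \<in> X - {ev j}. u \<in> e} \<le> card (S - {t} - B)"
    if "\<And>e. e \<in> X \<Longrightarrow> u \<in> e \<Longrightarrow> e \<noteq> ev j \<Longrightarrow> h e \<notin> B" for u B
  proof (rule card_inj_on_le[where f = h])
    show "inj_on h {e \<in> X - {ev j}. u \<in> e}"
      by (rule inj_on_incident[OF st, where u = u]) (auto simp: X_def)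
    show "h ` {e \<in> X - {ev j}. u \<in> e} \<subseteq> S - {t} - B"
      using that by (auto simp: X_def)
    show "finite (S - {t} - B)" using finS by simp
  qed
  have not_a: "h e \<noteq> h (od j)" if "e \<in> X" "e \<noteq> ev j" "u \<in> e" "u \<in> od j" for e u
  proof
    assume eq: "h e = h (od j)"
    have "e \<in> ?E" "e \<noteq> od j" using that XE by (auto simp: X_def)
    then have "h e = t" using state_clash[OF st _ od_color(1)[OF j]] that eq by blast
    then show False using eq od_t by simp
  qed
  have qm: "card (S - {t} - {b}) = q - 1" if "b \<in> S" "b \<noteq> t" for b
    using S finS that by simp
  \<comment> \<open>The extra edge \<open>ev j\<close> is compensated at one end by the missing colour \<open>c\<close> and at the other
    by the removal of \<open>od j\<close>.\<close>
  have deg: "card {e \<in> X. u \<in> e} \<le> q" for u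
  proof -
    have le: "card {e \<in> X. u \<in> e} \<le> Suc (card {e \<in> X - {ev j}. u \<in> e})"
    proof -
      have "card {e \<in> X. u \<in> e} \<le> card (insert (ev j) {e \<in> X - {ev j}. u \<in> e})"
        using finX by (intro card_mono) auto
      then show ?thesis using finX by simp
    qed
    consider "u \<notin> ev j" | "u = x (2 * j)" | "u = x (2 * j + 1)" unfolding ev_def by auto
    then show ?thesis
    proof cases
      case 1
      then have "{e \<in> X. u \<in> e} = {e \<in> X - {ev j}. u \<in> e}" by auto
      then show ?thesis using bound[of u "{}"] S finS by simp
    next
      case 2
      have "card {e \<in> X - {ev j}. u \<in> e} \<le> card (S - {t} - {c})"
        by (rule bound) (use state_missing[OF st] XE 2 in blast)
      then show ?thesis using le qm[of c] S(4) stateD(4,5)[OF st] q by simp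
    next
      case 3
      have "card {e \<in> X - {ev j}. u \<in> e} \<le> card (S - {t} - {h (od j)})"
        by (rule bound) (use not_a[of _ u] 3 in \<open>auto simp: od_def\<close>)
      then show ?thesis using le qm[of "h (od j)"] S(5) od_t q by simp
    qed
  qed
  obtain \<phi> where \<phi>: "\<phi> ` X \<subseteq> S - {t}" "proper_on X \<phi>"
    by (rule class_A_proper_on[OF class_A XE deg, of "S - {t}"]) (use S finS in auto)
  define h' where "h' e = (if e \<in> X then \<phi> e else if e = od j then t else h e)" for e
  let ?u = "x (2 * Suc j)"
  have u_od: "?u \<in> od j" by (simp add: od_def)
  have u_ev: "?u \<notin> ev j"
    using x_eq[of "2*j+2" "2*j"] x_eq[of "2*j+2" "2*j+1"] x_eq[of 0 "2*j"] x_eq[of 0 "2*j+1"] closed j k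
    by (cases "Suc j = k") (auto simp: ev_def)
  \<comment> \<open>At the next vertex \<open>od j\<close> has left \<open>X\<close> and no other
    edge of \<open>X\<close> there had its colour, so at most \<open>q - 1\<close> edges of
    \<open>X\<close> remain for \<open>q\<close> colours. A colour left over becomes
    \<open>c'\<close>.\<close>
  have "card (\<phi> ` {e \<in> X. ?u \<in> e}) < card (S - {t})"
  proof -
    have "{e \<in> X. ?u \<in> e} = {e \<in> X - {ev j}. ?u \<in> e}" using u_ev by auto
    moreover have "card {e \<in> X - {ev j}. ?u \<in> e} \<le> card (S - {t} - {h (od j)})"
      by (rule bound) (use not_a[of _ ?u] u_od in auto)
    moreover have "card (\<phi> ` {e \<in> X. ?u \<in> e}) \<le> card {e \<in> X. ?u \<in> e}"
      using finX by (simp add: card_image_le)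
    ultimately show ?thesis using qm[of "h (od j)"] S finS od_t q by simp
  qed
  then have "\<not> S - {t} \<subseteq> \<phi> ` {e \<in> X. ?u \<in> e}"
    using card_mono[of "\<phi> ` {e \<in> X. ?u \<in> e}" "S - {t}"] finX by auto
  then obtain c' where c': "c' \<in> S" "c' \<noteq> t" "c' \<notin> \<phi> ` {e \<in> X. ?u \<in> e}" by blast
  have h_out: "h e \<notin> S \<or> h e = t" if "e \<in> ?E" "e \<notin> X" "e \<noteq> od j" for e
    using that unfolding X_def by auto
  have "state (Suc j) h' c'"
    unfolding state_def
  proof (intro conjI ballI impI)
    show "h' ` ?E \<subseteq> {1..t}"
      using \<phi>(1) S(1,3) state_color[OF st] unfolding h'_def by (auto simp: image_subset_iff)
    show "c' \<in> {1..t}" "c' \<noteq> t" using c' S by auto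
  next
    fix e assume e: "e \<in> ?E"
    have "h' e = t \<longleftrightarrow> e \<notin> X \<and> (e = od j \<or> h e = t)" using \<phi> unfolding h'_def by auto
    also have "\<dots> \<longleftrightarrow> e = od j \<or> h e = t \<and> e \<noteq> ev j"
      using e od_t ev_t unfolding X_def by auto
    also have "\<dots> \<longleftrightarrow> e \<in> shifted (Suc j)"
      using state_shifted[OF st e] shifted_Suc[OF j] by auto
    finally show "h' e = t \<longleftrightarrow> e \<in> shifted (Suc j)" .
  next
    fix e e' assume e: "e \<in> ?E" "e' \<in> ?E" "e \<noteq> e' \<and> e \<inter> e' \<noteq> {} \<and> h' e = h' e'"
    show "h' e = t"
    proof (rule ccontr)
      assume nt: "h' e \<noteq> t"
      have out: "h' d \<notin> S" "h' d = h d" if "d \<in> ?E" "d \<notin> X" "h' d \<noteq> t" for d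
        using h_out[of d] that unfolding h'_def by (auto split: if_splits)
      have inS: "h' d \<in> S" if "d \<in> X" for d using that \<phi> unfolding h'_def by auto
      show False
      proof (cases "e \<in> X")
        case True
        then have "e' \<in> X" using e nt out(1)[of e'] inS[of e] by auto
        then show ?thesis using True \<phi>(2) e unfolding proper_on_def h'_def by auto
      next
        case False
        then have "e' \<notin> X" using e nt out(1)[of e] inS[of e'] by auto
        then have "h e = h e'" "h e \<noteq> t" using e nt out(2)[of e] out(2)[of e'] False by auto
        then show ?thesis using e state_clash[OF st] by blast
      qed
    qed
  next
    fix e assume e: "e \<in> ?E" "?u \<in> e"
    show "h' e \<noteq> c'"
      using h_out[OF e(1)] c' e unfolding h'_def by auto
  qed
  moreover have "agree_outside ?E S h h'"
    unfolding agree_outside_def h'_def using \<phi> S ev_t by (auto simp: X_def)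
  ultimately show thesis using that c' by blast
qed

text \<open>The only possible clash is at \<open>x (2 * j)\<close>, and the colour \<open>c\<close>
  missing there compensates for the doubled \<open>t\<close>. Hence the edges with colours in
  \<open>S\<close> have maximum degree at most \<open>q\<close> and can be recoloured from scratch
  with \<open>S\<close>. The class of \<open>t\<close> need not survive this.\<close>

lemma fix_state:
  assumes st: "state j h c" and j: "j \<le> k"
    and S: "S \<subseteq> {1..t}" "card S = q" "t \<in> S" "c \<in> S"
  obtains F where "proper_coloring G t F" "agree_outside (edges G) S h F"
proof -
  let ?E = "edges G"
  define X where "X = {e \<in> ?E. h e \<in> S}"
  have finS: "finite S" using S(1) finite_subset by blast
  have finX: "finite X" using finite_E unfolding X_def by simp
  have XE: "X \<subseteq> ?E" unfolding X_def by auto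
  have clash: "u = x (2 * j) \<and> (e = ev j \<or> e' = ev j)"
    if "e \<in> ?E" "e' \<in> ?E" "e \<noteq> e'" "u \<in> e" "u \<in> e'" "h e = h e'" for e e' u
  proof -
    have "h e = t" using that state_clash[OF st] by blast
    then show ?thesis using that state_shifted[OF st] shifted_conflict[OF j, of e e' u] by auto
  qed
  have deg: "card {e \<in> X. u \<in> e} \<le> q" for u
  proof (cases "u = x (2 * j)")
    case True
    \<comment> \<open>Without \<open>ev j\<close> the colours at \<open>u\<close> are distinct and
      avoid \<open>c\<close>; adding \<open>ev j\<close> back costs one.\<close>
    have "card {e \<in> X - {ev j}. u \<in> e} \<le> card (S - {c})"
    proof (rule card_inj_on_le[where f = h])
      show "inj_on h {e \<in> X - {ev j}. u \<in> e}"
        using clash[where u = u] XE by (auto simp: inj_on_def)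
      show "h ` {e \<in> X - {ev j}. u \<in> e} \<subseteq> S - {c}"
        using state_missing[OF st] True by (auto simp: X_def)
    qed (use finS in simp)
    moreover have "card {e \<in> X. u \<in> e} \<le> Suc (card {e \<in> X - {ev j}. u \<in> e})"
    proof -
      have "card {e \<in> X. u \<in> e} \<le> card (insert (ev j) {e \<in> X - {ev j}. u \<in> e})"
        using finX by (intro card_mono) auto
      then show ?thesis using finX by simp
    qed
    ultimately show ?thesis using S finS q by simp
  next
    case False
    have "card {e \<in> X. u \<in> e} \<le> card S"
    proof (rule card_inj_on_le[where f = h])
      show "inj_on h {e \<in> X. u \<in> e}"
        using clash[where u = u] XE False by (auto simp: inj_on_def)
    qed (use finS in \<open>auto simp: X_def\<close>)
    then show ?thesis using S by simp
  qed
  obtain \<phi> where \<phi>: "\<phi> ` X \<subseteq> S" "proper_on X \<phi>"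
    by (rule class_A_proper_on[OF class_A XE deg, of S]) (use S finS in auto)
  \<comment> \<open>Colourings are extensional on the edges, while states need not be.\<close>
  define F where "F = restrict (\<lambda>e. if e \<in> X then \<phi> e else h e) ?E"
  have "F \<in> ?E \<rightarrow>\<^sub>E {1..t}"
    using \<phi>(1) S(1) state_color[OF st] unfolding F_def by (fastforce simp: image_subset_iff)
  moreover have "proper_on ?E F"
    unfolding proper_on_def
  proof (intro ballI impI notI)
    fix e e' assume e: "e \<in> ?E" "e' \<in> ?E" "e \<noteq> e' \<and> e \<inter> e' \<noteq> {}" and eq: "F e = F e'"
    have "F d \<in> S \<longleftrightarrow> d \<in> X" if "d \<in> ?E" for d using that \<phi> unfolding F_def X_def by auto
    then have *: "e \<in> X \<longleftrightarrow> e' \<in> X" using e eq by metis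
    show False
    proof (cases "e \<in> X")
      case True
      then show ?thesis using * \<phi>(2) e eq unfolding proper_on_def F_def by auto
    next
      case False
      then have "h e = h e'" using * e eq unfolding F_def by auto
      moreover have "h e \<noteq> t" using False e S unfolding X_def by auto
      ultimately show ?thesis using e state_clash[OF st] by blast
    qed
  qed
  moreover have "agree_outside ?E S h F"
    unfolding agree_outside_def F_def using \<phi> by (auto simp: X_def)
  ultimately show thesis using that unfolding proper_coloring_iff by blast
qed

text \<open>Adding the colour of \<open>od j\<close> to \<open>S\<close> gives a set in which both
  the change from \<open>F\<close> back to \<open>h\<close> and the exchange of the next pair take
  place.\<close>

lemma state_step_linked:
  assumes st: "state j h c" and j: "j < k"
    and S: "S \<subseteq> {1..t}" "card S = q" "t \<in> S" "c \<in> S" "agree_outside (edges G) S F h"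
  obtains h' c' S' where "state (Suc j) h' c'" "agree_outside (edges G) S' F h'" "c' \<in> S'" "t \<in> S'"
    "S' \<subseteq> {1..t}" "card S' = q + 1"
proof -
  have finS: "finite S" using S(1) finite_subset by blast
  have "h (od j) \<in> {1..t}" using state_color[OF st od_color(1)[OF j]] .
  moreover have "card (insert (h (od j)) S) \<le> q + 1" using finS S by (simp add: card_insert_if)
  \<comment> \<open>If \<open>S\<close> already contains the colour of \<open>od j\<close>, another
    colour fills up the set; \<open>q + 1 \<le> t\<close> provides it.\<close>
  ultimately obtain S' where S': "insert (h (od j)) S \<subseteq> S'" "S' \<subseteq> {1..t}" "card S' = q + 1"
    using obtain_set_between[of "insert (h (od j)) S" "{1..t}" "q + 1"] S t by auto
  obtain h' c' where "state (Suc j) h' c'" "agree_outside (edges G) S' h h'" "c' \<in> S'"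
    by (rule step_state[OF st j, of S']) (use S S' in auto)
  moreover have "agree_outside (edges G) S' F h" by (rule agree_outside_mono[OF S(5)]) (use S' in simp)
  ultimately show thesis using that[of h' c' S'] agree_outside_trans[of "edges G" S' F h h'] S(3) S' by auto
qed

text \<open>Only the proper colourings \<open>F\<close> form the chain. The improper state
  \<open>h\<close> accompanies them, since it alone has exactly the intended class of
  \<open>t\<close>.\<close>

lemma linked_state:
  assumes c: "c \<in> {1..t}" "\<And>e. e \<in> edges G \<Longrightarrow> x 0 \<in> e \<Longrightarrow> f e \<noteq> c"
  shows "j < k \<Longrightarrow> \<exists>h c S F. state j h c \<and> (f, F) \<in> (recoloring_step G t (q + 1))\<^sup>* \<and>
    proper_coloring G t F \<and>
    S \<subseteq> {1..t} \<and> card S = q \<and> t \<in> S \<and> c \<in> S \<and> agree_outside (edges G) S F h"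
proof (induction j)
  case 0
  have "c \<noteq> t" using c(2)[of "ev 0"] ev_color[of 0] k by (simp add: ev_def)
  moreover have "f ` edges G \<subseteq> {1..t}" "proper_on (edges G) f"
    using proper unfolding proper_coloring_iff by auto
  ultimately have "state 0 f c"
    using c unfolding state_def shifted_def proper_on_def by (auto simp: color_class_def)
  moreover obtain S where "{t, c} \<subseteq> S" "S \<subseteq> {1..t}" "card S = q"
    by (rule obtain_set_between[of "{t, c}" "{1..t}" q]) (use c q t in \<open>auto simp: card_insert_if\<close>)
  moreover have "agree_outside (edges G) S f f" by (simp add: agree_outside_def)
  ultimately show ?case using proper by blast
next
  case (Suc j)
  then obtain h c S F where st: "state j h c" "(f, F) \<in> (recoloring_step G t (q + 1))\<^sup>*"
    "proper_coloring G t F"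
    "S \<subseteq> {1..t}" "card S = q" "t \<in> S" "c \<in> S" "agree_outside (edges G) S F h" by auto
  obtain h' c' S1 where h': "state (Suc j) h' c'" "agree_outside (edges G) S1 F h'" "c' \<in> S1" "t \<in> S1"
    "S1 \<subseteq> {1..t}" "card S1 = q + 1"
    by (rule state_step_linked[OF st(1) _ st(4-8)]) (use Suc.prems in auto)
  have fin: "finite S1" using h'(5) finite_subset by blast
  \<comment> \<open>Repairing inside \<open>S1\<close> keeps \<open>F\<close> and \<open>F'\<close>
    within the same \<open>q + 1\<close> colours, so that they are a single step apart.\<close>
  obtain S2 where S2: "{t, c'} \<subseteq> S2" "S2 \<subseteq> S1" "card S2 = q"
    by (rule obtain_set_between[of "{t, c'}" S1 q]) (use h' fin q in \<open>auto simp: card_insert_if\<close>)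
  obtain F' where F': "proper_coloring G t F'" "agree_outside (edges G) S2 h' F'"
    by (rule fix_state[OF h'(1), of S2]) (use Suc.prems S2 h' in auto)
  have "agree_outside (edges G) S1 F F'"
    using agree_outside_trans[OF h'(2)] agree_outside_mono[OF F'(2) S2(2)] by blast
  then have "(F, F') \<in> recoloring_step G t (q + 1)"
    using differ_at_most_if_agree_outside[of G S1 F F'] fin h'(6) F'(1) st(3)
    unfolding recoloring_step_def by simp
  then have "(f, F') \<in> (recoloring_step G t (q + 1))\<^sup>*" using st(2) by simp
  moreover have "S2 \<subseteq> {1..t}" "t \<in> S2" "c' \<in> S2" using S2 h'(5) by auto
  ultimately show ?case using h'(1) F'(1) S2(3) agree_outside_sym[OF F'(2)] by blast
qed

text \<open>The last pair is treated separately: the state for \<open>k\<close> has no clash left,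
  so it is proper without a repair, which could spoil its class of \<open>t\<close>.\<close>

lemma exchange:
  assumes c: "c \<in> {1..t}" "\<And>e. e \<in> edges G \<Longrightarrow> x 0 \<in> e \<Longrightarrow> f e \<noteq> c"
  obtains f' where "proper_coloring G t f'" "(f, f') \<in> (recoloring_step G t (q + 1))\<^sup>*"
    "color_class G f' t = color_class G f t - ev ` {..<k} \<union> od ` {..<k}"
proof -
  obtain j where j: "k = Suc j" using k by (cases k) auto
  obtain h c S F where st: "state j h c" "(f, F) \<in> (recoloring_step G t (q + 1))\<^sup>*"
    "proper_coloring G t F"
    "S \<subseteq> {1..t}" "card S = q" "t \<in> S" "c \<in> S" "agree_outside (edges G) S F h"
    using linked_state[OF c, of j] j by auto
  obtain h' c' S1 where h': "state k h' c'" "agree_outside (edges G) S1 F h'" "c' \<in> S1" "t \<in> S1"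
    "S1 \<subseteq> {1..t}" "card S1 = q + 1"
    by (rule state_step_linked[OF st(1) _ st(4-8)]) (use j in auto)
  have fin: "finite S1" using h'(5) finite_subset by blast
  define f' where "f' = restrict h' (edges G)"
  have "f' \<in> edges G \<rightarrow>\<^sub>E {1..t}" using state_color[OF h'(1)] unfolding f'_def by auto
  moreover have "proper_on (edges G) f'"
    unfolding proper_on_def
  proof (intro ballI impI notI)
    fix e e' assume e: "e \<in> edges G" "e' \<in> edges G" "e \<noteq> e' \<and> e \<inter> e' \<noteq> {}" and eq: "f' e = f' e'"
    then have eq': "h' e = h' e'" by (simp add: f'_def)
    then have "h' e = t" using e state_clash[OF h'(1)] by blast
    then have "e \<in> shifted k" "e' \<in> shifted k" using e eq' state_shifted[OF h'(1)] by auto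
    then show False using shifted_conflict[of k e e'] e by blast
  qed
  ultimately have p: "proper_coloring G t f'" by (simp add: proper_coloring_iff)
  have "agree_outside (edges G) S1 F f'" using h'(2) by (simp add: agree_outside_def f'_def)
  then have "(F, f') \<in> recoloring_step G t (q + 1)"
    using differ_at_most_if_agree_outside[of G S1 F f'] fin h'(6) p st(3)
    unfolding recoloring_step_def by simp
  then have "(f, f') \<in> (recoloring_step G t (q + 1))\<^sup>*" using st(2) by simp
  moreover have "color_class G f' t = shifted k"
    using state_shifted[OF h'(1)] shifted_subset[of k] by (auto simp: color_class_def f'_def)
  ultimately show thesis using that p unfolding shifted_def by blast
qed

end

section \<open>Extending a recolouring of one side of a cutvertex to the whole graph\<close>

text \<open>A bijection of \<open>X\<close> onto a part of \<open>Y\<close> is glued to one between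
  the complements, which have equal size.\<close>

lemma bij_betw_image_into:
  assumes "finite D" "X \<subseteq> D" "Y \<subseteq> D" "card X \<le> card Y"
  obtains \<sigma> where "bij_betw \<sigma> D D" "\<sigma> ` X \<subseteq> Y"
proof -
  obtain Y' where Y': "Y' \<subseteq> Y" "card Y' = card X"
    using obtain_subset_with_card_n[OF assms(4)] by blast
  have fin: "finite X" "finite Y'" using assms Y' by (meson finite_subset)+
  obtain a where a: "bij_betw a X Y'"
    using finite_same_card_bij[OF fin] Y' by auto
  have "card (D - X) = card (D - Y')"
    using assms Y' fin by (simp add: card_Diff_subset)
  then obtain b where b: "bij_betw b (D - X) (D - Y')"
    using finite_same_card_bij[of "D - X" "D - Y'"] assms(1) by auto
  define \<sigma> where "\<sigma> d = (if d \<in> X then a d else b d)" for d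
  have "bij_betw \<sigma> X Y'" using a by (subst bij_betw_cong[of _ _ a]) (auto simp: \<sigma>_def)
  moreover have "bij_betw \<sigma> (D - X) (D - Y')"
    using b by (subst bij_betw_cong[of _ _ b]) (auto simp: \<sigma>_def)
  ultimately have "bij_betw \<sigma> (X \<union> (D - X)) (Y' \<union> (D - Y'))" by (rule bij_betw_combine) blast
  moreover have "X \<union> (D - X) = D" "Y' \<union> (D - Y') = D" using assms Y' by auto
  moreover have "\<sigma> ` X \<subseteq> Y" using a Y' by (auto simp: \<sigma>_def bij_betw_def)
  ultimately show thesis using that by simp
qed

text \<open>Permuting the changed colours \<open>D\<close> on \<open>E2\<close> keeps
  \<open>E2\<close> proper and changes no class outside \<open>D\<close>. The permutation only has
  to avoid clashes with \<open>z\<close> at \<open>v\<close>, and a count of the colours of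
  \<open>D\<close> at \<open>v\<close> shows that this is possible.\<close>

lemma recoloring_step_lift:
  assumes E: "edges G = E1 \<union> E2" and disj: "E1 \<inter> E2 = {}"
    and meet: "\<And>e e'. e \<in> E1 \<Longrightarrow> e' \<in> E2 \<Longrightarrow> e \<inter> e' \<subseteq> {v}"
    and fin: "finite (edges G)"
    and step: "(y, z) \<in> recoloring_step (Graph V E1) t n"
    and p: "proper_coloring G t p" and py: "\<And>e. e \<in> E1 \<Longrightarrow> p e = y e"
  obtains \<sigma> p' where "bij_betw \<sigma> {1..t} {1..t}" "(p, p') \<in> recoloring_step G t n"
    "\<And>e. e \<in> E1 \<Longrightarrow> p' e = z e" "\<And>e. e \<in> E2 \<Longrightarrow> p' e = \<sigma> (p e)"
proof -
  let ?H = "Graph V E1"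
  define D where "D = {j \<in> {1..t}. color_class ?H y j \<noteq> color_class ?H z j}"
  have Dt: "D \<subseteq> {1..t}" and finD: "finite D" by (auto simp: D_def)
  have y: "y \<in> E1 \<rightarrow>\<^sub>E {1..t}" "proper_on E1 y" and z: "z \<in> E1 \<rightarrow>\<^sub>E {1..t}" "proper_on E1 z"
    and cardD: "card D \<le> n"
    using step by (auto simp: recoloring_step_def proper_coloring_iff differ_at_most_def D_def)
  have pt: "p \<in> edges G \<rightarrow>\<^sub>E {1..t}" and pp: "proper_on (edges G) p"
    using p by (auto simp: proper_coloring_iff)
  \<comment> \<open>An edge that changes colour leaves one class and joins another, so both colours
    are in \<open>D\<close>.\<close>
  have yz: "y e = z e \<or> y e \<in> D \<and> z e \<in> D" if e: "e \<in> E1" for e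
  proof -
    have "z e = y e" if "y e \<notin> D"
    proof -
      have "color_class ?H y (y e) = color_class ?H z (y e)" using that y e by (auto simp: D_def)
      then show ?thesis using e by (auto simp: color_class_def)
    qed
    moreover have "y e = z e" if "z e \<notin> D"
    proof -
      have "color_class ?H y (z e) = color_class ?H z (z e)" using that z e by (auto simp: D_def)
      then show ?thesis using e by (auto simp: color_class_def)
    qed
    ultimately show ?thesis by metis
  qed
  define A where "A = {e \<in> E1. v \<in> e \<and> y e \<in> D}"
  have finA: "finite A" using fin E by (simp add: A_def)
  have zA: "z e \<in> D \<longleftrightarrow> y e \<in> D" if "e \<in> E1" for e using yz[OF that] by metis
  have "inj_on y A" using proper_onD[OF y(2), of _ _ v] by (auto simp: A_def inj_on_def)
  then have cy: "card (y ` A) = card A" by (rule card_image)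
  have "inj_on z A" using proper_onD[OF z(2), of _ _ v] by (auto simp: A_def inj_on_def)
  then have cz: "card (z ` A) = card A" by (rule card_image)
  \<comment> \<open>These colours are to be moved to colours of \<open>D\<close> that
    \<open>z\<close> does not use on \<open>A\<close>. There is room, because \<open>y\<close> uses
    on \<open>A\<close> equally many colours, all in \<open>D\<close> and none in
    \<open>B\<close>.\<close>
  define B where "B = {p e |e. e \<in> E2 \<and> v \<in> e} \<inter> D"
  have BA: "B \<inter> y ` A = {}"
  proof (rule ccontr)
    assume "B \<inter> y ` A \<noteq> {}"
    then obtain e e' where e: "e \<in> E2" "v \<in> e" "e' \<in> A" "p e = y e'" unfolding B_def by blast
    then have "p e = p e'" "e' \<in> E1" "v \<in> e'" using py by (auto simp: A_def)
    then have "e = e'" using proper_onD[OF pp, of e e' v] e E by auto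
    then show False using \<open>e' \<in> E1\<close> e disj by auto
  qed
  have "card B + card (y ` A) = card (B \<union> y ` A)"
    using BA finA finD by (subst card_Un_disjoint) (auto simp: B_def)
  also have "\<dots> \<le> card D" using finD by (intro card_mono) (auto simp: A_def B_def)
  finally have "card B + card A \<le> card D" using cy by simp
  moreover have "z ` A \<subseteq> D" using zA by (auto simp: A_def)
  ultimately have "card B \<le> card (D - z ` A)"
    using cz card_Diff_subset[of "z ` A" D] finA by simp
  then obtain \<sigma>0 where \<sigma>0: "bij_betw \<sigma>0 D D" "\<sigma>0 ` B \<subseteq> D - z ` A"
    using bij_betw_image_into[OF finD, of B "D - z ` A"] by (auto simp: B_def)
  define \<sigma> where "\<sigma> j = (if j \<in> D then \<sigma>0 j else j)" for j
  have "bij_betw \<sigma> D D" using \<sigma>0(1) by (subst bij_betw_cong[of _ _ \<sigma>0]) (auto simp: \<sigma>_def)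
  moreover have "bij_betw \<sigma> ({1..t} - D) ({1..t} - D)" by (auto simp: \<sigma>_def bij_betw_def inj_on_def)
  ultimately have "bij_betw \<sigma> (D \<union> ({1..t} - D)) (D \<union> ({1..t} - D))" by (rule bij_betw_combine) blast
  then have \<sigma>: "bij_betw \<sigma> {1..t} {1..t}" using Dt by (simp add: Un_absorb1)
  have \<sigma>D: "\<sigma> j \<in> D" if "j \<in> D" for j using that \<sigma>0 by (auto simp: \<sigma>_def bij_betw_def)
  define p' where "p' = restrict (\<lambda>e. if e \<in> E1 then z e else \<sigma> (p e)) (edges G)"
  have p1: "p' e = z e" if "e \<in> E1" for e using that E by (simp add: p'_def)
  have p2: "p' e = \<sigma> (p e)" if "e \<in> E2" for e using that E disj by (auto simp: p'_def)
  \<comment> \<open>For a colour in \<open>D\<close> on \<open>E2\<close> the choice of the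
    permutation excludes a clash. Otherwise both edges would have kept their colours, and
    \<open>p\<close> was proper.\<close>
  have cross: "p' e \<noteq> p' e'" if e: "e \<in> E1" "e' \<in> E2" "e \<inter> e' \<noteq> {}" for e e'
  proof
    assume eq: "p' e = p' e'"
    have v: "v \<in> e" "v \<in> e'" using meet[OF e(1,2)] e(3) by auto
    have ne: "y e \<noteq> p e'"
      using proper_onD[OF pp, of e e' v] e v py E disj by auto
    show False
    proof (cases "p e' \<in> D")
      case True
      then have "p e' \<in> B" using e v by (auto simp: B_def)
      then have "p' e' \<in> D - z ` A" using \<sigma>0 True p2[OF e(2)] by (auto simp: \<sigma>_def)
      then have "z e \<in> D" "z e \<notin> z ` A" using eq p1[OF e(1)] by auto
      then show ?thesis using e(1) v zA[OF e(1)] by (simp add: A_def)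
    next
      case False
      then have "z e = p e'" using eq p1[OF e(1)] p2[OF e(2)] by (simp add: \<sigma>_def)
      then show ?thesis using yz[OF e(1)] False ne by auto
    qed
  qed
  have "p' e \<in> {1..t}" if "e \<in> edges G" for e
  proof (cases "e \<in> E1")
    case True
    then show ?thesis using PiE_mem[OF z(1)] p1 by simp
  next
    case False
    then show ?thesis using PiE_mem[OF pt that] bij_betwE[OF \<sigma>] p2 E that by simp
  qed
  then have "p' \<in> edges G \<rightarrow>\<^sub>E {1..t}" by (simp add: p'_def PiE_iff)
  moreover have "proper_on (edges G) p'"
    unfolding proper_on_def
  proof (intro ballI impI)
    fix e e' assume e: "e \<in> edges G" "e' \<in> edges G" "e \<noteq> e' \<and> e \<inter> e' \<noteq> {}"
    consider "e \<in> E1" "e' \<in> E1" | "e \<in> E1" "e' \<in> E2" | "e \<in> E2" "e' \<in> E1" | "e \<in> E2" "e' \<in> E2"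
      using e E by auto
    then show "p' e \<noteq> p' e'"
    proof cases
      case 1
      then show ?thesis using p1 z(2) e by (auto simp: proper_on_def)
    next
      case 2
      then show ?thesis using cross e by blast
    next
      case 3
      then show ?thesis using cross[of e' e] e by (metis Int_commute)
    next
      case 4
      have "p e \<noteq> p e'" using pp e by (auto simp: proper_on_def)
      moreover have "p e \<in> {1..t}" "p e' \<in> {1..t}" using pt e by auto
      ultimately show ?thesis
        using 4 p2 inj_on_eq_iff[OF bij_betw_imp_inj_on[OF \<sigma>]] by metis
    qed
  qed
  ultimately have "proper_coloring G t p'" by (simp add: proper_coloring_iff)
  moreover have "agree_outside (edges G) D p p'"
    unfolding agree_outside_def
  proof
    fix e assume "e \<in> edges G"
    then consider "e \<in> E1" | "e \<in> E2" using E by auto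
    then show "p e = p' e \<or> p e \<in> D \<and> p' e \<in> D"
    proof cases
      case 1
      then show ?thesis using yz py p1 by auto
    next
      case 2
      then show ?thesis using p2 \<sigma>D by (auto simp: \<sigma>_def)
    qed
  qed
  ultimately have "(p, p') \<in> recoloring_step G t n"
    using p differ_at_most_if_agree_outside[OF _ finD cardD] by (auto simp: recoloring_step_def)
  then show thesis using that \<sigma> p1 p2 by blast
qed

text \<open>The permutations of the single steps compose, so \<open>E2\<close> keeps its colour
  classes up to renaming.\<close>

lemma recoloring_steps_lift:
  assumes E: "edges G = E1 \<union> E2" and disj: "E1 \<inter> E2 = {}"
    and meet: "\<And>e e'. e \<in> E1 \<Longrightarrow> e' \<in> E2 \<Longrightarrow> e \<inter> e' \<subseteq> {v}"
    and fin: "finite (edges G)"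
    and p: "proper_coloring G t p" and py: "\<And>e. e \<in> E1 \<Longrightarrow> p e = y e"
    and steps: "(y, z) \<in> (recoloring_step (Graph V E1) t n)\<^sup>*"
  shows "\<exists>\<pi> p'. bij_betw \<pi> {1..t} {1..t} \<and> (p, p') \<in> (recoloring_step G t n)\<^sup>* \<and>
    proper_coloring G t p' \<and> (\<forall>e\<in>E1. p' e = z e) \<and> (\<forall>e\<in>E2. p' e = \<pi> (p e))"
  using steps
proof (induction rule: rtrancl_induct)
  case base
  then show ?case using p py by (intro exI[of _ "\<lambda>j. j"] exI[of _ p]) (auto simp: bij_betw_def)
next
  case (step z z')
  then obtain \<pi> p' where *: "bij_betw \<pi> {1..t} {1..t}" "(p, p') \<in> (recoloring_step G t n)\<^sup>*"
    "proper_coloring G t p'" "\<forall>e\<in>E1. p' e = z e" "\<forall>e\<in>E2. p' e = \<pi> (p e)" by blast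
  obtain \<sigma> p'' where **: "bij_betw \<sigma> {1..t} {1..t}" "(p', p'') \<in> recoloring_step G t n"
    "\<And>e. e \<in> E1 \<Longrightarrow> p'' e = z' e" "\<And>e. e \<in> E2 \<Longrightarrow> p'' e = \<sigma> (p' e)"
    by (rule recoloring_step_lift[OF E disj meet fin step.hyps(2) *(3)]) (use *(4) in auto)
  have "bij_betw (\<sigma> \<circ> \<pi>) {1..t} {1..t}" using *(1) **(1) by (rule bij_betw_trans)
  moreover have "(p, p'') \<in> (recoloring_step G t n)\<^sup>*" using *(2) **(2) by (rule rtrancl_into_rtrancl)
  moreover have "proper_coloring G t p''" using **(2) by (simp add: recoloring_step_def)
  moreover have "\<forall>e\<in>E1. p'' e = z' e" "\<forall>e\<in>E2. p'' e = (\<sigma> \<circ> \<pi>) (p e)" using **(3,4) *(5) by auto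
  ultimately show ?case by blast
qed

section \<open>From chains of recolouring steps to \<open>n_equivalent\<close>\<close>

lemma sym_recoloring_step: "sym (recoloring_step G t n)"
proof -
  have "{j \<in> {1..t}. color_class G f j \<noteq> color_class G h j} =
    {j \<in> {1..t}. color_class G h j \<noteq> color_class G f j}" for f h
    by auto
  then show ?thesis by (auto simp: sym_def recoloring_step_def differ_at_most_def)
qed

lemma n_equivalent_if_recoloring_steps:
  assumes "(f, h) \<in> (recoloring_step G t n)\<^sup>*" "proper_coloring G t f"
  shows "n_equivalent G t n f h"
proof -
  \<comment> \<open>The definition asks for a sequence with \<open>k \<ge> 1\<close>; a trivial
    first step covers an empty chain.\<close>
  have "(f, f) \<in> recoloring_step G t n"
    using assms(2) by (simp add: recoloring_step_def differ_at_most_def)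
  then have "(f, h) \<in> (recoloring_step G t n)\<^sup>+" using assms(1) by (rule rtrancl_into_trancl2)
  then obtain k where k: "k > 0" "(f, h) \<in> recoloring_step G t n ^^ k"
    by (auto simp: trancl_power)
  then obtain F where F: "F 0 = f" "F k = h" "\<And>i. i < k \<Longrightarrow> (F i, F (Suc i)) \<in> recoloring_step G t n"
    by (auto simp: relpow_fun_conv)
  have "proper_coloring G t (F i)" if "i \<le> k" for i
    using F(1) F(3)[of "i - 1"] that assms(2) by (cases i) (auto simp: recoloring_step_def)
  moreover have "differ_at_most G t n (F i) (F (i - 1))" if "i \<in> {1..k}" for i
    using symD[OF sym_recoloring_step F(3)[of "i - 1"]] that by (auto simp: recoloring_step_def)
  ultimately show ?thesis using k F(1,2) unfolding n_equivalent_def by (intro exI[of _ k]) auto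
qed

section \<open>Reachability, components and cutvertices\<close>

definition reach :: "'a graph \<Rightarrow> 'a \<Rightarrow> 'a set" where
  "reach G x = {(u, w). {u, w} \<in> edges G}\<^sup>* `` {x}"

definition induced :: "'a graph \<Rightarrow> 'a set \<Rightarrow> 'a graph" where
  "induced G U = Graph U {e \<in> edges G. e \<subseteq> U}"

lemma reach_refl: "x \<in> reach G x"
  by (simp add: reach_def)

lemma reach_step: "u \<in> reach G x \<Longrightarrow> {u, w} \<in> edges G \<Longrightarrow> w \<in> reach G x"
  using rtrancl_into_rtrancl[of x u "{(u, w). {u, w} \<in> edges G}" w] by (simp add: reach_def)

lemma reach_induct [consumes 1, case_names refl step]:
  assumes "u \<in> reach G x" "P x"
    and "\<And>u w. u \<in> reach G x \<Longrightarrow> {u, w} \<in> edges G \<Longrightarrow> P u \<Longrightarrow> P w"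
  shows "P u"
proof -
  have "(x, u) \<in> {(u, w). {u, w} \<in> edges G}\<^sup>*" using assms(1) by (simp add: reach_def)
  then show ?thesis
    by (induction rule: rtrancl_induct) (use assms(2,3) in \<open>auto simp: reach_def\<close>)
qed

lemma reach_sym: "u \<in> reach G x \<Longrightarrow> x \<in> reach G u"
proof -
  have "sym {(u, w). {u, w} \<in> edges G}" by (auto simp: sym_def insert_commute)
  then show "u \<in> reach G x \<Longrightarrow> x \<in> reach G u"
    unfolding reach_def by (auto dest: symD[OF sym_rtrancl])
qed

lemma reach_trans: "u \<in> reach G x \<Longrightarrow> w \<in> reach G u \<Longrightarrow> w \<in> reach G x"
  unfolding reach_def by auto

lemma reach_subset_verts:
  assumes "simple_graph G" "x \<in> verts G"
  shows "reach G x \<subseteq> verts G"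
proof
  fix u assume "u \<in> reach G x"
  then show "u \<in> verts G"
    by (induction rule: reach_induct) (use assms in \<open>auto simp: simple_graph_def\<close>)
qed

lemma connected_graph_iff: "connected_graph G \<longleftrightarrow> verts G \<noteq> {} \<and> (\<forall>u\<in>verts G. verts G \<subseteq> reach G u)"
  unfolding connected_graph_def reach_def by auto

lemma reach_mono: "edges H \<subseteq> edges G \<Longrightarrow> reach H x \<subseteq> reach G x"
  using rtrancl_mono[of "{(u, w). {u, w} \<in> edges H}" "{(u, w). {u, w} \<in> edges G}"]
  by (auto simp: reach_def)

lemma simple_graph_edgeE:
  assumes "simple_graph G" "e \<in> edges G" "u \<in> e"
  obtains w where "e = {u, w}" "u \<noteq> w"
proof -
  have "card e = 2" using assms by (simp add: simple_graph_def)
  then obtain a b where "e = {a, b}" "a \<noteq> b" by (auto simp: card_2_iff)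
  then show thesis using that[of a] that[of b] assms(3) by (auto simp: insert_commute)
qed

lemma connected_subgraph_of_reach:
  assumes "subgraph D G" "connected_graph D" "x \<in> verts D"
  shows "subgraph D (induced G (reach G x))"
proof -
  have "verts D \<subseteq> reach G x"
    using assms reach_mono[of D G x] by (auto simp: connected_graph_iff subgraph_def)
  then show ?thesis
    using assms(1) by (auto simp: subgraph_def induced_def simple_graph_def)
qed

lemma induced_reach:
  assumes "simple_graph G" "x \<in> verts G"
  shows "subgraph (induced G (reach G x)) G" "connected_graph (induced G (reach G x))"
proof -
  let ?I = "induced G (reach G x)"
  show "subgraph ?I G"
    using assms reach_subset_verts[OF assms] finite_subset
    by (auto simp: subgraph_def induced_def simple_graph_def)
  have "u \<in> reach ?I x" if "u \<in> reach G x" for u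
    using that
  proof (induction rule: reach_induct)
    case refl
    then show ?case by (rule reach_refl)
  next
    case (step u w)
    then have "{u, w} \<in> edges ?I" using reach_step[of u G x w] by (auto simp: induced_def)
    then show ?case using step reach_step by metis
  qed
  then have "w \<in> reach ?I u" if "u \<in> reach G x" "w \<in> reach G x" for u w
    using that reach_trans[of x ?I u w] reach_sym[of u ?I x] by blast
  then show "connected_graph ?I"
    unfolding connected_graph_iff using reach_refl[of x G] by (auto simp: induced_def)
qed

text \<open>A connected subgraph through \<open>x\<close> lies in the graph induced on
  \<open>reach G x\<close>, which is itself connected; so these induced graphs are the maximal
  ones.\<close>

lemma components_eq:
  assumes "simple_graph G"
  shows "components G = induced G ` reach G ` verts G"
proof -
  have antisym: "D = H" if "subgraph D H" "subgraph H D" for D H :: "'a graph"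
    using that by (auto simp: subgraph_def intro: graph.expand)
  show ?thesis
  proof (intro subset_antisym subsetI)
    fix K assume K: "K \<in> components G"
    then obtain x where x: "x \<in> verts K" by (auto simp: components_def connected_graph_def)
    then have "x \<in> verts G" using K by (auto simp: components_def subgraph_def)
    moreover have "subgraph K (induced G (reach G x))"
      using connected_subgraph_of_reach[of K G x] K x by (simp add: components_def)
    ultimately have "induced G (reach G x) = K"
      using K induced_reach[OF assms] unfolding components_def by blast
    then show "K \<in> induced G ` reach G ` verts G" using \<open>x \<in> verts G\<close> by blast
  next
    fix K assume "K \<in> induced G ` reach G ` verts G"
    then obtain x where x: "x \<in> verts G" "K = induced G (reach G x)" by blast
    have "D = K" if "subgraph D G" "connected_graph D" "subgraph K D" for D
    proof -
      have "x \<in> verts D" using that(3) x reach_refl[of x G] by (auto simp: subgraph_def induced_def)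
      then show ?thesis using connected_subgraph_of_reach[OF that(1,2)] that(3) x(2) antisym by blast
    qed
    then show "K \<in> components G" using induced_reach[OF assms x(1)] x(2) by (simp add: components_def)
  qed
qed

lemma card_components:
  assumes "simple_graph G"
  shows "card (components G) = card (reach G ` verts G)"
  unfolding components_eq[OF assms]
  by (rule card_image) (auto simp: inj_on_def induced_def)

lemma simple_delete_vertex: "simple_graph G \<Longrightarrow> simple_graph (delete_vertex G v)"
  by (auto simp: simple_graph_def delete_vertex_def)

lemma delete_vertex_edge: "{u, w} \<in> edges (delete_vertex G v) \<longleftrightarrow> {u, w} \<in> edges G \<and> u \<noteq> v \<and> w \<noteq> v"
  by (auto simp: delete_vertex_def)

text \<open>If all neighbours of \<open>v\<close> were in the component of \<open>u\<close> after
  deleting \<open>v\<close>, the deletion would merely take \<open>v\<close> out of the sets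
  \<open>reach G x\<close>, and the number of components could not grow.\<close>

lemma cutvertex_neighbor_outside:
  assumes G: "simple_graph G" and cut: "cutvertex G v" and u: "{v, u} \<in> edges G"
  obtains w where "{v, w} \<in> edges G" "w \<notin> reach (delete_vertex G v) u"
proof (rule ccontr)
  note result = that
  assume outside: "\<not> thesis"
  have nb: "w \<in> reach (delete_vertex G v) u" if "{v, w} \<in> edges G" for w
    using result outside that by blast
  let ?H = "delete_vertex G v"
  have H: "simple_graph ?H" using G by (rule simple_delete_vertex)
  have vH: "verts ?H = verts G - {v}" by (simp add: delete_vertex_def)
  \<comment> \<open>A walk through \<open>v\<close> is rerouted. While it stands at
    \<open>v\<close>, the reachability of \<open>u\<close> is recorded instead, from which every
    neighbour of \<open>v\<close> can be reached.\<close>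
  have "(if w = v then u \<in> reach ?H x else w \<in> reach ?H x)"
    if "x \<noteq> v" "w \<in> reach G x" for x w
    using that(2)
  proof (induction rule: reach_induct)
    case refl
    then show ?case using that(1) reach_refl by simp
  next
    case (step a b)
    show ?case
    proof (cases "a = v")
      case True
      then have "b \<noteq> v" using step(2) G by (auto simp: simple_graph_def)
      then show ?thesis using True step nb[of b] reach_trans[of u ?H x b] by auto
    next
      case a: False
      show ?thesis
      proof (cases "b = v")
        case True
        then have "a \<in> reach ?H u" using nb[of a] step(2) by (simp add: insert_commute)
        then show ?thesis using True a step(3) reach_sym reach_trans by (metis (full_types))
      next
        case False
        then show ?thesis using a step reach_step[of a ?H x b] by (auto simp: delete_vertex_edge)
      qed
    qed
  qed
  then have "reach G x - {v} \<subseteq> reach ?H x" if "x \<noteq> v" for x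
    using that by (metis Diff_iff insertI1 subsetI)
  moreover have "reach ?H x \<subseteq> reach G x" for x
    by (rule reach_mono) (auto simp: delete_vertex_def)
  ultimately have "reach ?H x = reach G x - {v}" if "x \<in> verts ?H" for x
    using that reach_subset_verts[OF H that] unfolding vH by blast
  then have "reach ?H ` verts ?H \<subseteq> (\<lambda>U. U - {v}) ` reach G ` verts G" by (auto simp: vH)
  moreover have fin: "finite (verts G)" using G by (simp add: simple_graph_def)
  ultimately have "card (reach ?H ` verts ?H) \<le> card (reach G ` verts G)"
    by (meson card_image_le card_mono finite_imageI le_trans)
  then show False using cut card_components[OF G] card_components[OF H] by (simp add: cutvertex_def)
qed

section \<open>Enumerating the cycle from the cutvertex with alternating membership in the two
  classes\<close>

lemma cycle_enumeration:
  assumes "is_cycle C" "v \<in> verts C"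
  obtains x and n :: nat where "3 \<le> n" "inj_on x {..<n}" "x n = x 0" "x 0 = v"
    "\<And>i. i < n \<Longrightarrow> {x i, x (Suc i)} \<in> edges C"
proof -
  obtain vs where vs: "distinct vs" "length vs \<ge> 3" "verts C = set vs"
    "edges C = {{vs ! i, vs ! (Suc i mod length vs)} |i. i < length vs}"
    using assms(1) unfolding is_cycle_def by blast
  let ?n = "length vs"
  obtain m where m: "m < ?n" "vs ! m = v" using assms(2) vs(3) by (auto simp: in_set_conv_nth)
  \<comment> \<open>The vertex list rotated to start at \<open>v\<close>; indices modulo the length
    give \<open>x n = x 0\<close>.\<close>
  define x where "x i = vs ! ((m + i) mod ?n)" for i
  have pos: "?n > 0" using vs(2) by linarith
  show thesis
  proof
    show "3 \<le> ?n" by (rule vs(2))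
    show "inj_on x {..<?n}"
    proof (rule inj_onI)
      fix i j assume ij: "i \<in> {..<?n}" "j \<in> {..<?n}" "x i = x j"
      then have "rotate m vs ! i = rotate m vs ! j" by (simp add: x_def nth_rotate)
      then show "i = j" using ij vs(1) by (simp add: nth_eq_iff_index_eq)
    qed
    show "x ?n = x 0" "x 0 = v" using m by (simp_all add: x_def)
    fix i
    have "Suc ((m + i) mod ?n) mod ?n = (m + Suc i) mod ?n" by (simp add: mod_Suc_eq)
    then show "{x i, x (Suc i)} \<in> edges C"
      unfolding vs(4) x_def using pos by (auto intro!: exI[of _ "(m + i) mod ?n"])
  qed
qed

text \<open>Each edge has colour \<open>t\<close> under exactly one of \<open>f\<close> and
  \<open>g\<close>, and two edges sharing a vertex cannot have it under the same one. So consecutive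
  edges alternate, and closing up at \<open>x 0\<close> forces \<open>n\<close> to be even.\<close>

lemma alternating_enumeration_oriented:
  fixes n :: nat
  assumes n: "3 \<le> n" and inj: "inj_on x {..<n}" and closed: "x n = x 0"
    and F: "proper_on E f" and H: "proper_on E g"
    and alt: "\<And>i. i < n \<Longrightarrow> {x i, x (Suc i)} \<in> sym_diff {e \<in> E. f e = t} {e \<in> E. g e = t}"
    and first: "f {x 0, x 1} = t"
  obtains k where "n = 2 * k" "\<And>i. i < n \<Longrightarrow> f {x i, x (Suc i)} = t \<longleftrightarrow> even i"
proof -
  have x: "x a = x b \<longleftrightarrow> a = b" if "a < n" "b < n" for a b using inj that by (auto simp: inj_on_def)
  have E: "{x i, x (Suc i)} \<in> E" and fg: "f {x i, x (Suc i)} = t \<longleftrightarrow> g {x i, x (Suc i)} \<noteq> t" if "i < n" for i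
    using alt[OF that] by auto
  have switch: "f e = t \<longleftrightarrow> f e' \<noteq> t"
    if "e \<in> E" "e' \<in> E" "u \<in> e" "u \<in> e'" "e \<noteq> e'" "f e = t \<longleftrightarrow> g e \<noteq> t" "f e' = t \<longleftrightarrow> g e' \<noteq> t" for e e' u
    using proper_onD[OF F, of e e' u] proper_onD[OF H, of e e' u] that by auto
  have parity: "f {x i, x (Suc i)} = t \<longleftrightarrow> even i" if "i < n" for i
    using that
  proof (induction i)
    case 0
    then show ?case using first by simp
  next
    case (Suc i)
    have "x i \<noteq> x (Suc i)" using x[of i "Suc i"] Suc.prems by simp
    \<comment> \<open>At the last edge \<open>x (Suc (Suc i))\<close> is \<open>x 0\<close>, which
      differs from \<open>x i\<close> because \<open>n\<close> is at least 3.\<close>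
    moreover have "x i \<noteq> x (Suc (Suc i))"
      using x[of i "Suc (Suc i)"] x[of i 0] closed Suc.prems n by (cases "Suc (Suc i) = n") auto
    ultimately have "{x i, x (Suc i)} \<noteq> {x (Suc i), x (Suc (Suc i))}" by (auto simp: doubleton_eq_iff)
    then have "f {x i, x (Suc i)} = t \<longleftrightarrow> f {x (Suc i), x (Suc (Suc i))} \<noteq> t"
      by (intro switch[of _ _ "x (Suc i)"]) (use E fg Suc.prems in auto)
    then show ?case using Suc by auto
  qed
  have last: "{x (n - 1), x 0} \<in> E" "f {x (n - 1), x 0} = t \<longleftrightarrow> g {x (n - 1), x 0} \<noteq> t"
    "f {x (n - 1), x 0} = t \<longleftrightarrow> even (n - 1)"
    using E[of "n - 1"] fg[of "n - 1"] parity[of "n - 1"] n closed by auto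
  have "x 1 \<noteq> x (n - 1)" using x[of 1 "n - 1"] n by auto
  moreover have "x 0 \<noteq> x 1" using x[of 0 1] n by auto
  ultimately have "{x 0, x 1} \<noteq> {x (n - 1), x 0}" by (simp add: doubleton_eq_iff)
  then have "f {x 0, x 1} = t \<longleftrightarrow> f {x (n - 1), x 0} \<noteq> t"
    using switch[of "{x 0, x 1}" "{x (n - 1), x 0}" "x 0"] E[of 0] fg[of 0] last(1,2) n by simp
  then have "even n" using first last(3) n by auto
  then show thesis using that parity by blast
qed

lemma alternating_enumeration:
  fixes G :: "'a graph"
  assumes f: "proper_coloring G t f" and g: "proper_coloring G t g"
    and C: "subgraph C (diff_subgraph G f g t)" "is_cycle C" "v \<in> verts C"
  obtains x :: "nat \<Rightarrow> 'a" and k where "2 \<le> k" "inj_on x {..<2 * k}" "x (2 * k) = x 0" "x 0 = v"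
    "\<And>i. i < k \<Longrightarrow> {x (2 * i), x (2 * i + 1)} \<in> color_class G f t - color_class G g t"
    "\<And>i. i < k \<Longrightarrow> {x (2 * i + 1), x (2 * i + 2)} \<in> color_class G g t - color_class G f t"
proof -
  note result = that
  let ?E = "edges G"
  have F: "proper_on ?E f" and H: "proper_on ?E g" using f g by (auto simp: proper_coloring_iff)
  obtain x n where x: "3 \<le> n" "inj_on x {..<n}" "x n = x 0" "x 0 = v"
    "\<And>i. i < n \<Longrightarrow> {x i, x (Suc i)} \<in> edges C"
    using cycle_enumeration[OF C(2,3)] by blast
  have "edges C \<subseteq> sym_diff {e \<in> ?E. f e = t} {e \<in> ?E. g e = t}"
    using C(1) by (auto simp: subgraph_def diff_subgraph_def Let_def color_class_def)
  then have alt: "{x i, x (Suc i)} \<in> sym_diff {e \<in> ?E. f e = t} {e \<in> ?E. g e = t}" if "i < n" for i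
    using x(5)[OF that] by blast
  have conclude: thesis
    if y: "inj_on y {..<n}" "y n = y 0" "y 0 = v" "f {y 0, y 1} = t"
      "\<And>i. i < n \<Longrightarrow> {y i, y (Suc i)} \<in> sym_diff {e \<in> ?E. f e = t} {e \<in> ?E. g e = t}" for y
  proof -
    obtain k where k: "n = 2 * k" "\<And>i. i < n \<Longrightarrow> f {y i, y (Suc i)} = t \<longleftrightarrow> even i"
      using alternating_enumeration_oriented[OF x(1) y(1,2) F H y(5,4)] by blast
    show thesis
    proof (rule result)
      show "2 \<le> k" using k(1) x(1) by linarith
      show "inj_on y {..<2 * k}" "y (2 * k) = y 0" "y 0 = v" using y k(1) by auto
      fix i assume "i < k"
      then show "{y (2 * i), y (2 * i + 1)} \<in> color_class G f t - color_class G g t"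
        using y(5)[of "2 * i"] k(1) k(2)[of "2 * i"] by (auto simp: color_class_def)
      show "{y (2 * i + 1), y (2 * i + 2)} \<in> color_class G g t - color_class G f t"
        using \<open>i < k\<close> y(5)[of "2 * i + 1"] k(1) k(2)[of "2 * i + 1"] by (auto simp: color_class_def)
    qed
  qed
  show thesis
  proof (cases "f {x 0, x 1} = t")
    case True
    then show ?thesis using conclude[of x] x alt by blast
  next
    case False
    \<comment> \<open>The cycle is traversed backwards: the two edges at \<open>v\<close> cannot
      both have colour \<open>t\<close> under \<open>g\<close>, so the other one has it under
      \<open>f\<close>.\<close>
    define y where "y i = x (n - i)" for i
    have xe: "x a = x b \<longleftrightarrow> a = b" if "a < n" "b < n" for a b using x(2) that by (auto simp: inj_on_def)
    have "inj_on y {..<n}"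
    proof (rule inj_onI)
      fix i j assume ij: "i \<in> {..<n}" "j \<in> {..<n}" "y i = y j"
      then show "i = j"
        using xe[of "n - i" "n - j"] xe[of 0 "n - j"] xe[of "n - i" 0] x(3)
        by (cases "i = 0"; cases "j = 0") (auto simp: y_def)
    qed
    moreover have "y n = y 0" "y 0 = v" using x(3,4) by (auto simp: y_def)
    moreover have alt_y: "{y i, y (Suc i)} \<in> sym_diff {e \<in> ?E. f e = t} {e \<in> ?E. g e = t}" if "i < n" for i
    proof -
      have "{y i, y (Suc i)} = {x (n - Suc i), x (Suc (n - Suc i))}"
        using that by (simp add: y_def Suc_diff_Suc insert_commute)
      then show ?thesis using alt[of "n - Suc i"] that by simp
    qed
    moreover have "f {y 0, y 1} = t"
    proof (rule ccontr)
      assume nt: "f {y 0, y 1} \<noteq> t"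
      have "x 0 \<noteq> x 1" "x (n - 1) \<noteq> x 1" using xe[of 0 1] xe[of "n - 1" 1] x(1) by auto
      then have "{y 0, y 1} \<noteq> {x 0, x 1}" using x(3) by (auto simp: y_def doubleton_eq_iff)
      moreover have "{y 0, y 1} \<in> ?E" "g {y 0, y 1} = t"
        using alt_y[of 0] nt x(1) by auto
      moreover have "{x 0, x 1} \<in> ?E" "g {x 0, x 1} = t" using alt[of 0] False x(1) by auto
      ultimately show False
        using proper_onD[OF H, of "{y 0, y 1}" "{x 0, x 1}" "x 0"] x(3) by (auto simp: y_def)
    qed
    ultimately show ?thesis using conclude[of y] by blast
  qed
qed

section \<open>Combining the exchange on one side with the permutation of colours on the
  other\<close>

theorem corollary3p1:
  fixes G C :: "'a graph" and q t :: nat and f g :: "'a set \<Rightarrow> nat" and v :: 'a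
  assumes "q \<ge> 3"
    and "G \<in> class_A q"
    and "max_degree G = t"
    and "t \<ge> q + 2"
    and "proper_coloring G t f"
    and "proper_coloring G t g"
    and "f \<noteq> g"
    and "C \<in> components (diff_subgraph G f g t)"
    and "is_cycle C"
    and "v \<in> verts C"
    and "cutvertex G v"
  shows "\<exists>f'. proper_coloring G t f' \<and> n_equivalent G t (q + 1) f' f \<and>
    card (color_class G f' t \<inter> color_class G g t) > card (color_class G f t \<inter> color_class G g t)"
proof -
  let ?E = "edges G" and ?R = "recoloring_step G t (q + 1)"
  have G: "simple_graph G" using assms(2) by (rule class_A_simple)
  then have finE: "finite ?E" by (rule finite_edges)
  have F: "f \<in> ?E \<rightarrow>\<^sub>E {1..t}" "proper_on ?E f" using assms(5) by (auto simp: proper_coloring_iff)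
  obtain x :: "nat \<Rightarrow> 'a" and k where k: "2 \<le> k" and inj: "inj_on x {..<2 * k}" and closed: "x (2 * k) = x 0" and x0: "x 0 = v"
    and even: "\<And>i. i < k \<Longrightarrow> {x (2 * i), x (2 * i + 1)} \<in> color_class G f t - color_class G g t"
    and odd: "\<And>i. i < k \<Longrightarrow> {x (2 * i + 1), x (2 * i + 2)} \<in> color_class G g t - color_class G f t"
    by (rule alternating_enumeration[OF assms(5,6) _ assms(9,10)]) (use assms(8) in \<open>auto simp: components_def\<close>)
  have evE: "{x (2 * i), x (2 * i + 1)} \<in> ?E" and odE: "{x (2 * i + 1), x (2 * i + 2)} \<in> ?E" if "i < k" for i
    using even[OF that] odd[OF that] by (auto simp: color_class_def)
  let ?H = "delete_vertex G v"
  \<comment> \<open>The component of \<open>G\<close> without \<open>v\<close> that contains the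
    rest of the cycle. Adding \<open>v\<close> gives the side \<open>E1\<close>, which meets the
    remaining edges only at \<open>v\<close>.\<close>
  define U where "U = reach ?H (x 1)"
  define E1 where "E1 = {e \<in> ?E. e \<subseteq> insert v U}"
  define E2 where "E2 = ?E - E1"
  have split: "?E = E1 \<union> E2" "E1 \<inter> E2 = {}" "E1 \<subseteq> ?E" by (auto simp: E1_def E2_def)
  have meet: "e \<inter> e' \<subseteq> {v}" if e: "e \<in> E1" "e' \<in> E2" for e e'
  proof (rule ccontr)
    assume "\<not> e \<inter> e' \<subseteq> {v}"
    then obtain a where a: "a \<in> e" "a \<in> e'" "a \<noteq> v" by blast
    then have aU: "a \<in> U" using e by (auto simp: E1_def)
    obtain b where b: "e' = {a, b}" using simple_graph_edgeE[OF G _ a(2)] e(2) by (auto simp: E2_def)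
    have "b \<noteq> v \<Longrightarrow> b \<in> U"
      using reach_step[of a ?H "x 1" b] aU a b e(2) by (auto simp: U_def delete_vertex_edge E2_def)
    then show False using aU b e(2) by (auto simp: E1_def E2_def)
  qed
  have xv: "x i \<noteq> v" if "0 < i" "i < 2 * k" for i
    using inj_onD[OF inj, of i 0] that x0 by auto
  have edge: "{x i, x (Suc i)} \<in> ?E" if "i < 2 * k" for i
    using evE[of "i div 2"] odE[of "i div 2"] that by (cases "even i") (auto elim!: evenE oddE)
  have xU: "0 < i \<Longrightarrow> i < 2 * k \<Longrightarrow> x i \<in> U" for i
  proof (induction i)
    case (Suc i)
    show ?case
    proof (cases "i = 0")
      case True
      then show ?thesis by (simp add: U_def reach_refl)
    next
      case False
      then show ?thesis
        using Suc edge[of i] xv[of i] xv[of "Suc i"] reach_step[of "x i" ?H "x 1" "x (Suc i)"]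
        by (auto simp: U_def delete_vertex_edge)
    qed
  qed simp
  have xU': "x i \<in> insert v U" if "i \<le> 2 * k" for i
    using xU[of i] that x0 closed by (cases "i = 0"; cases "i = 2 * k") auto
  have ev1: "{x (2 * i), x (2 * i + 1)} \<in> E1" and od1: "{x (2 * i + 1), x (2 * i + 2)} \<in> E1" if "i < k" for i
    using evE[OF that] odE[OF that] xU'[of "2 * i"] xU'[of "2 * i + 1"] xU'[of "2 * i + 2"] that
    by (auto simp: E1_def)
  have "{v, x 1} \<in> ?E" using evE[of 0] k x0 by auto
  \<comment> \<open>The edge to \<open>w\<close> lies outside \<open>E1\<close>, so its colour under
    \<open>f\<close> is missing at \<open>v\<close> within \<open>E1\<close>, as the exchange
    requires.\<close>
  then obtain w where w: "{v, w} \<in> ?E" "w \<notin> U"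
    using cutvertex_neighbor_outside[OF G assms(11)] unfolding U_def by blast
  then have w2: "{v, w} \<in> E2" using G by (auto simp: E2_def E1_def simple_graph_def)
  let ?G1 = "Graph (verts G) E1"
  define f1 where "f1 = restrict f E1"
  have G1A: "?G1 \<in> class_A q" using class_A_edge_subset[OF assms(2) split(3)] .
  have f1: "proper_coloring ?G1 t f1"
    using F split(3) by (auto simp: proper_coloring_iff f1_def proper_on_def)
  have cc1: "color_class ?G1 f1 t = color_class G f t \<inter> E1"
    using split(3) by (auto simp: color_class_def f1_def)
  interpret cycle: alternating_cycle ?G1 q t f1 x k
  proof
    fix i assume "i < k"
    then show "{x (2 * i), x (2 * i + 1)} \<in> color_class ?G1 f1 t"
      "{x (2 * i + 1), x (2 * i + 2)} \<in> edges ?G1 - color_class ?G1 f1 t"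
      using even odd ev1 od1 cc1 by auto
  qed (use G1A f1 assms k inj closed in auto)
  have miss: "f1 e \<noteq> f {v, w}" if "e \<in> edges ?G1" "x 0 \<in> e" for e
    using proper_onD[OF F(2), of e "{v, w}" v] that w w2 split x0 by (auto simp: f1_def)
  obtain z where z: "proper_coloring ?G1 t z" "(f1, z) \<in> (recoloring_step ?G1 t (q + 1))\<^sup>*"
    "color_class ?G1 z t = color_class ?G1 f1 t - cycle.ev ` {..<k} \<union> cycle.od ` {..<k}"
    by (rule cycle.exchange[of "f {v, w}"]) (use F(1) w miss in auto)
  have "\<exists>\<pi> p. bij_betw \<pi> {1..t} {1..t} \<and> (f, p) \<in> ?R\<^sup>* \<and>
    proper_coloring G t p \<and> (\<forall>e\<in>E1. p e = z e) \<and> (\<forall>e\<in>E2. p e = \<pi> (f e))"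
    by (rule recoloring_steps_lift[OF split(1,2) meet finE assms(5) _ z(2)]) (auto simp: f1_def)
  then obtain \<pi> p where \<pi>: "bij_betw \<pi> {1..t} {1..t}" and p: "(f, p) \<in> ?R\<^sup>*" "proper_coloring G t p"
    "\<forall>e\<in>E1. p e = z e" "\<forall>e\<in>E2. p e = \<pi> (f e)" by blast
  have P: "p \<in> ?E \<rightarrow>\<^sub>E {1..t}" "proper_on ?E p" using p(2) by (auto simp: proper_coloring_iff)
  have t1: "t \<in> {1..t}" using assms(4) by simp
  have \<pi>t: "\<pi> t \<in> {1..t}" using \<pi> t1 by (auto simp: bij_betw_def)
  have \<pi>_eq: "\<pi> (f e) = \<pi> t \<longleftrightarrow> f e = t" if "e \<in> ?E" for e
    using inj_on_eq_iff[OF bij_betw_imp_inj_on[OF \<pi>]] F(1) that t1 by blast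
  \<comment> \<open>On \<open>E2\<close> the edges that had colour \<open>t\<close> under
    \<open>f\<close> now have colour \<open>\<pi> t\<close>; the transposition returns them to
    \<open>t\<close>.\<close>
  define f' where "f' = restrict (\<lambda>e. if e \<in> E1 then p e else transpose t (\<pi> t) (p e)) ?E"
  have q1: "f' e = p e" if "e \<in> E1" for e using that split(3) by (auto simp: f'_def)
  have q2: "f' e = transpose t (\<pi> t) (p e)" if "e \<in> E2" for e using that split(1,2) by (auto simp: f'_def)
  have last: "cycle.od (k - 1) \<in> E1" "v \<in> cycle.od (k - 1)" "p (cycle.od (k - 1)) = t"
  proof -
    have k1: "2 * (k - 1) + 2 = 2 * k" using k by simp
    show "cycle.od (k - 1) \<in> E1" using od1[of "k - 1"] k by (simp add: cycle.od_def)
    show "v \<in> cycle.od (k - 1)" using k1 closed x0 by (simp add: cycle.od_def)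
    have "cycle.od (k - 1) \<in> color_class ?G1 z t" using z(3) k by auto
    then show "p (cycle.od (k - 1)) = t" using p(3) by (auto simp: color_class_def)
  qed
  \<comment> \<open>Neither swapped colour occurs at \<open>v\<close> on \<open>E2\<close>:
    \<open>t\<close> is taken there by the last odd edge under \<open>p\<close>, and
    \<open>\<pi> t\<close> would come from an edge of colour \<open>t\<close> under
    \<open>f\<close>, while that edge at \<open>v\<close> is the first edge of the cycle, in
    \<open>E1\<close>.\<close>
  have q2v: "f' e = p e" if "e \<in> E2" "v \<in> e" for e
  proof -
    have e: "e \<in> ?E" "e \<notin> E1" using that split by auto
    have "p e \<noteq> t" using proper_onD[OF P(2), of e "cycle.od (k - 1)" v] last e that split by auto
    moreover have "f e \<noteq> t"
      using proper_onD[OF F(2), of e "{x 0, x 1}" v] even[of 0] ev1[of 0] k x0 e that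
      by (auto simp: color_class_def)
    then have "p e \<noteq> \<pi> t" using p(4) that e \<pi>_eq by auto
    ultimately show ?thesis using q2[OF that(1)] by (simp add: transpose_def)
  qed
  have "f' \<in> ?E \<rightarrow>\<^sub>E {1..t}"
    using P(1) t1 \<pi>t by (auto simp: f'_def transpose_def)
  moreover have "proper_on ?E f'"
    unfolding proper_on_def
  proof (intro ballI impI)
    fix e e' assume e: "e \<in> ?E" "e' \<in> ?E" "e \<noteq> e' \<and> e \<inter> e' \<noteq> {}"
    then have ne: "p e \<noteq> p e'" using P(2) by (auto simp: proper_on_def)
    consider "e \<in> E1" "e' \<in> E1" | "e \<in> E1" "e' \<in> E2" | "e \<in> E2" "e' \<in> E1" | "e \<in> E2" "e' \<in> E2"
      using e split by auto
    then show "f' e \<noteq> f' e'"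
    proof cases
      case 1
      then show ?thesis using q1 ne by simp
    next
      case 2
      then have "v \<in> e'" using meet e by blast
      then show ?thesis using 2 q1 q2v ne by simp
    next
      case 3
      then have "v \<in> e" using meet e by blast
      then show ?thesis using 3 q1 q2v ne by simp
    next
      case 4
      then show ?thesis using q2 ne injD[OF inj_transpose] by metis
    qed
  qed
  ultimately have f': "proper_coloring G t f'" by (simp add: proper_coloring_iff)
  have "agree_outside ?E {t, \<pi> t} p f'"
    using split by (auto simp: agree_outside_def f'_def transpose_def)
  then have "differ_at_most G t (q + 1) p f'"
    by (rule differ_at_most_if_agree_outside) (use assms(1) in \<open>auto simp: card_insert_if\<close>)
  then have "(f, f') \<in> ?R\<^sup>*"
    by (intro rtrancl_into_rtrancl[OF p(1)]) (use p(2) f' in \<open>simp add: recoloring_step_def\<close>)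
  then have "(f', f) \<in> ?R\<^sup>*" by (rule symD[OF sym_rtrancl[OF sym_recoloring_step]])
  then have "n_equivalent G t (q + 1) f' f" using f' by (rule n_equivalent_if_recoloring_steps)
  \<comment> \<open>On \<open>E1\<close> only edges outside the class of \<open>g\<close> were given
    up, and on \<open>E2\<close> the class of \<open>f\<close> is restored. The last odd edge is a
    new common edge.\<close>
  moreover have "color_class G f t \<inter> color_class G g t \<subset> color_class G f' t \<inter> color_class G g t"
  proof
    have "f' e = t" if e: "e \<in> ?E" "f e = t" "g e = t" for e
    proof (cases "e \<in> E1")
      case True
      then have "e \<in> color_class ?G1 f1 t" using e cc1 by (auto simp: color_class_def)
      moreover have "e \<notin> cycle.ev ` {..<k}" using even e(3) by (auto simp: cycle.ev_def color_class_def)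
      ultimately have "e \<in> color_class ?G1 z t" using z(3) by blast
      then show ?thesis using True q1 p(3) by (auto simp: color_class_def)
    next
      case False
      then have "e \<in> E2" using e split by auto
      then show ?thesis using q2 p(4) e(2) by (simp add: transpose_def)
    qed
    then show "color_class G f t \<inter> color_class G g t \<subseteq> color_class G f' t \<inter> color_class G g t"
      by (auto simp: color_class_def)
    have "cycle.od (k - 1) \<in> color_class G g t - color_class G f t" using odd[of "k - 1"] k by (simp add: cycle.od_def)
    moreover have "cycle.od (k - 1) \<in> color_class G f' t"
      using last q1 split(3) by (auto simp: color_class_def)
    ultimately show "color_class G f t \<inter> color_class G g t \<noteq> color_class G f' t \<inter> color_class G g t"
      by blast
  qed
  then have "card (color_class G f t \<inter> color_class G g t) < card (color_class G f' t \<inter> color_class G g t)"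
    using finE by (intro psubset_card_mono) (auto simp: color_class_def)
  ultimately show ?thesis using f' by blast
qed

end
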